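(* For every integer $m\ge 3$, the number of isomorphism classes of modular maximal-cyclic braces of size $2^{m+2}$ with non-cyclic additive group is at least $4m-5$.
   Context: A (right) brace is a set $A$ with two group structures $+$ and $\circ$ such that $(A,+)$ is abelian and $(b+c)\circ a+a=b\circ a+c\circ a$ for all $a,b,c\in A$. The group $(A,\circ)$ is the adjoint group. A modular maximal-cyclic brace of size $2^{m+2}$ is a brace whose adjoint group is isomorphic to $M_{2^{m+2}}=\langle a,b\mid a^{2^{m+1}}=b^2=1,\ bab^{-1}=a^{1+2^m}\rangle$. Two braces are isomorphic if there is a bijection between them that preserves both $+$ and $\circ$. *)

theory Defs
  imports "HOL-Algebra.Algebra"
begin

text \<open>A brace is encoded in the ring record: \<open>\<oplus>\<close> is the additive operation and \<open>\<otimes>\<close> is the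
  operation \<open>\<circ>\<close> of the adjoint group. Thus \<open>A\<close> itself, seen as a monoid record, is
  the adjoint group, and \<open>add_monoid A\<close> is the additive group.\<close>

locale brace = abelian_group A + group A for A (structure) +
  assumes brace_distrib:
    "\<lbrakk>a \<in> carrier A; b \<in> carrier A; c \<in> carrier A\<rbrakk>
      \<Longrightarrow> ((b \<oplus> c) \<otimes> a) \<oplus> a = (b \<otimes> a) \<oplus> (c \<otimes> a)"

definition brace_iso :: "('a, 'm) ring_scheme \<Rightarrow> ('b, 'n) ring_scheme \<Rightarrow> ('a \<Rightarrow> 'b) set"
  where "brace_iso A B = iso (add_monoid A) (add_monoid B) \<inter> iso A B"

definition brace_isomorphic :: "('a, 'm) ring_scheme \<Rightarrow> ('b, 'n) ring_scheme \<Rightarrow> bool"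
  where "brace_isomorphic A B \<longleftrightarrow> brace_iso A B \<noteq> {}"

definition brace_iso_classes :: "('a, 'm) ring_scheme set \<Rightarrow> ('a, 'm) ring_scheme set set"
  where "brace_iso_classes S = S // {(A, B). A \<in> S \<and> B \<in> S \<and> brace_isomorphic A B}"

text \<open>A letter \<open>(x, True)\<close> stands for the generator \<open>x\<close> and \<open>(x, False)\<close> for its inverse.\<close>

type_synonym 'g word = "('g \<times> bool) list"

text \<open>The least congruence on words that contains free cancellation and the defining
  relations, where a pair \<open>(u, v)\<close> in \<open>R\<close> is the relation \<open>u = v\<close>.\<close>

inductive pres_cong :: "('g word \<times> 'g word) set \<Rightarrow> 'g word \<Rightarrow> 'g word \<Rightarrow> bool"
  for R where
  pres_refl: "pres_cong R u u"
| pres_sym: "pres_cong R u v \<Longrightarrow> pres_cong R v u"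
| pres_trans: "pres_cong R u v \<Longrightarrow> pres_cong R v w \<Longrightarrow> pres_cong R u w"
| pres_append: "pres_cong R u v \<Longrightarrow> pres_cong R u' v' \<Longrightarrow> pres_cong R (u @ u') (v @ v')"
| pres_cancel: "pres_cong R [(x, e), (x, \<not> e)] []"
| pres_rel: "(u, v) \<in> R \<Longrightarrow> pres_cong R u v"

definition word_class :: "('g word \<times> 'g word) set \<Rightarrow> 'g word \<Rightarrow> 'g word set"
  where "word_class R u = {v. pres_cong R u v}"

definition presented_group :: "('g word \<times> 'g word) set \<Rightarrow> 'g word set monoid"
  where "presented_group R =
    \<lparr>carrier = range (word_class R),
     monoid.mult = (\<lambda>U V. \<Union>u\<in>U. \<Union>v\<in>V. word_class R (u @ v)),
     one = word_class R []\<rparr>"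

lemma word_class_eq_iff: "word_class R u = word_class R v \<longleftrightarrow> pres_cong R u v"
proof
  assume "word_class R u = word_class R v"
  then have "v \<in> word_class R u" by (simp add: word_class_def pres_refl)
  then show "pres_cong R u v" by (simp add: word_class_def)
next
  assume uv: "pres_cong R u v"
  have "pres_cong R u w \<longleftrightarrow> pres_cong R v w" for w
    using pres_trans[OF uv, of w] pres_trans[OF pres_sym[OF uv], of w] by blast
  then show "word_class R u = word_class R v" by (simp add: word_class_def)
qed

lemma presented_group_mult:
  "word_class R u \<otimes>\<^bsub>presented_group R\<^esub> word_class R v = word_class R (u @ v)"
proof -
  have eq: "word_class R (u' @ v') = word_class R (u @ v)"
    if "u' \<in> word_class R u" "v' \<in> word_class R v" for u' v'
  proof -
    have "pres_cong R u u'" "pres_cong R v v'" using that by (simp_all add: word_class_def)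
    then show ?thesis using pres_append word_class_eq_iff by metis
  qed
  have mem: "u \<in> word_class R u" "v \<in> word_class R v"
    by (simp_all add: word_class_def pres_refl)
  have "(\<Union>u'\<in>word_class R u. \<Union>v'\<in>word_class R v. word_class R (u' @ v')) =
    (\<Union>u'\<in>word_class R u. \<Union>v'\<in>word_class R v. word_class R (u @ v))"
    using eq by (intro SUP_cong refl)
  also have "\<dots> = word_class R (u @ v)" using mem by blast
  finally show ?thesis by (simp add: presented_group_def)
qed

lemma word_left_inverse: "\<exists>v. pres_cong R (v @ u) []"
proof (induction u)
  case Nil
  show ?case by (rule exI[of _ "[]"]) (simp add: pres_refl)
next
  case (Cons p u)
  obtain x e where p: "p = (x, e)" by fastforce
  obtain v where v: "pres_cong R (v @ u) []" using Cons.IH by blast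
  have "pres_cong R ([(x, \<not> e), (x, e)] @ u) ([] @ u)"
    using pres_append[OF pres_cancel[of R x "\<not> e"] pres_refl] by simp
  then have "pres_cong R (v @ ([(x, \<not> e), (x, e)] @ u)) (v @ ([] @ u))"
    by (rule pres_append[OF pres_refl])
  then have "pres_cong R ((v @ [(x, \<not> e)]) @ p # u) []"
    using pres_trans[OF _ v] p by simp
  then show ?case by blast
qed

lemma group_presented_group: "group (presented_group R)"
proof -
  let ?G = "presented_group R"
  have one: "\<one>\<^bsub>?G\<^esub> = word_class R []" and carr: "carrier ?G = range (word_class R)"
    by (simp_all add: presented_group_def)
  have inv: "\<exists>V\<in>carrier ?G. V \<otimes>\<^bsub>?G\<^esub> word_class R u = \<one>\<^bsub>?G\<^esub>" for u
  proof -
    obtain v where "pres_cong R (v @ u) []" using word_left_inverse by blast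
    then have "word_class R v \<otimes>\<^bsub>?G\<^esub> word_class R u = \<one>\<^bsub>?G\<^esub>"
      by (simp add: one presented_group_mult word_class_eq_iff)
    then show ?thesis unfolding carr by blast
  qed
  show ?thesis
  proof (rule groupI)
    fix U assume "U \<in> carrier ?G"
    then show "\<exists>V\<in>carrier ?G. V \<otimes>\<^bsub>?G\<^esub> U = \<one>\<^bsub>?G\<^esub>"
      using inv unfolding carr by blast
  qed (auto simp: one carr presented_group_mult)
qed

datatype gen = GenA | GenB

text \<open>The presentation \<open>\<langle>a, b | a^(2^(m+1)) = b^2 = 1, b a b^(-1) = a^(1+2^m)\<rangle>\<close> with
  \<open>a\<close>, \<open>b\<close> written \<open>GenA\<close>, \<open>GenB\<close> and the empty word as \<open>1\<close>.\<close>

definition modular_maximal_cyclic_group :: "nat \<Rightarrow> gen word set monoid"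
  where "modular_maximal_cyclic_group m = presented_group
    {(replicate (2 ^ (m + 1)) (GenA, True), []),
     ([(GenB, True), (GenB, True)], []),
     ([(GenB, True), (GenA, True), (GenB, False)], replicate (1 + 2 ^ m) (GenA, True))}"

definition modular_maximal_cyclic_brace :: "nat \<Rightarrow> ('a, 'm) ring_scheme \<Rightarrow> bool"
  where "modular_maximal_cyclic_brace m A \<longleftrightarrow>
    brace A \<and> A \<cong> modular_maximal_cyclic_group m"

text \<open>Isomorphism classes are counted among the braces whose carrier is a set of natural numbers.
  The braces in question are finite, so every isomorphism class is represented there.
  Operations are total functions whose values outside the carrier do not affect the class.\<close>

definition noncyclic_mmc_braces :: "nat \<Rightarrow> nat ring set"
  where "noncyclic_mmc_braces m =
    {A. modular_maximal_cyclic_brace m A \<and> \<not> cyclic_group (add_monoid A)}"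

end

theory Submission
  imports Defs
begin

text \<open>
  Write \<open>N = 2^(m+1)\<close>. For \<open>2 \<le> k \<le> m\<close> and \<open>c, d \<in> {0, 1}\<close> put on \<open>\<int>/N \<times> \<int>/2\<close> the operation
  \[ (x, y) \circ (x', y') = (x + x' + 2^k x x' + 2^m (d x y' + (1 - d) x' y)
      + 2^m c x \tbinom{x'}{2},\; y + y' + c x x'). \]
  It is affine in the left argument, which gives the brace law, and \<open>(1, 0)\<close>, \<open>(0, 1)\<close> satisfy the
  defining relations of the modular maximal-cyclic group. The \<open>4(m - 1)\<close> braces obtained in this
  way are told apart by the product \<open>s * t = s \<circ> t - s - t\<close>: the exponent of the additive group
  generated by all products is \<open>2^(m+1-k)\<close>; all products are in \<open>2A\<close> iff \<open>c = 0\<close>; and an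
  involution outside \<open>2A\<close> annihilates \<open>A\<close> from the left iff \<open>d = 1\<close>.
\<close>

subsection \<open>Isomorphisms of braces\<close>

lemma brace_isoI:
  assumes "bij_betw f (carrier A) (carrier B)"
    and "\<And>x y. x \<in> carrier A \<Longrightarrow> y \<in> carrier A \<Longrightarrow> f (x \<oplus>\<^bsub>A\<^esub> y) = f x \<oplus>\<^bsub>B\<^esub> f y"
    and "\<And>x y. x \<in> carrier A \<Longrightarrow> y \<in> carrier A \<Longrightarrow> f (x \<otimes>\<^bsub>A\<^esub> y) = f x \<otimes>\<^bsub>B\<^esub> f y"
  shows "f \<in> brace_iso A B"
  using assms bij_betw_imp_funcset[OF assms(1)] by (simp add: brace_iso_def iso_def hom_def)

lemma brace_isoD:
  assumes "f \<in> brace_iso A B"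
  shows "bij_betw f (carrier A) (carrier B)"
    and "\<And>x y. x \<in> carrier A \<Longrightarrow> y \<in> carrier A \<Longrightarrow> f (x \<oplus>\<^bsub>A\<^esub> y) = f x \<oplus>\<^bsub>B\<^esub> f y"
    and "\<And>x y. x \<in> carrier A \<Longrightarrow> y \<in> carrier A \<Longrightarrow> f (x \<otimes>\<^bsub>A\<^esub> y) = f x \<otimes>\<^bsub>B\<^esub> f y"
  using assms by (simp_all add: brace_iso_def iso_def hom_def)

lemma brace_isomorphic_refl: "brace_isomorphic A A"
  using brace_isoI[of "\<lambda>x. x" A A] by (auto simp: brace_isomorphic_def bij_betw_def)

lemma brace_isomorphic_sym:
  assumes "brace A" "brace_isomorphic A B"
  shows "brace_isomorphic B A"
proof -
  interpret brace A by fact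
  obtain f where "f \<in> iso (add_monoid A) (add_monoid B)" "f \<in> iso A B"
    using assms(2) by (auto simp: brace_isomorphic_def brace_iso_def)
  then have "inv_into (carrier A) f \<in> brace_iso B A"
    using group.iso_set_sym[OF a_group] iso_set_sym by (force simp: brace_iso_def)
  then show ?thesis
    by (auto simp: brace_isomorphic_def)
qed

lemma brace_isomorphic_trans:
  assumes "brace_isomorphic A B" "brace_isomorphic B C"
  shows "brace_isomorphic A C"
proof -
  obtain f g where "f \<in> brace_iso A B" "g \<in> brace_iso B C"
    using assms by (auto simp: brace_isomorphic_def)
  then have "g \<circ> f \<in> brace_iso A C"
    by (auto simp: brace_iso_def intro: iso_set_trans)
  then show ?thesis
    by (auto simp: brace_isomorphic_def)
qed

lemma equiv_brace_isomorphic: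
  assumes "\<And>A. A \<in> S \<Longrightarrow> brace A"
  shows "equiv S {(A, B). A \<in> S \<and> B \<in> S \<and> brace_isomorphic A B}"
proof (rule equivI)
  show "refl_on S {(A, B). A \<in> S \<and> B \<in> S \<and> brace_isomorphic A B}"
    by (auto simp: refl_on_def brace_isomorphic_refl)
  show "sym {(A, B). A \<in> S \<and> B \<in> S \<and> brace_isomorphic A B}"
    using assms brace_isomorphic_sym by (auto simp: sym_def)
  show "trans {(A, B). A \<in> S \<and> B \<in> S \<and> brace_isomorphic A B}"
    by (rule transI) (auto intro: brace_isomorphic_trans)
qed auto

section \<open>Counting isomorphism classes\<close>

text \<open>Once the carriers are numbered by \<open>{0..<n}\<close>, both operations become tables
  on a finite set; equal tables give isomorphic braces, and there are only finitely many tables.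
  Finiteness matters because \<open>card\<close> of an infinite set is \<open>0\<close>, which would
  defeat a lower bound.\<close>

lemma finite_brace_iso_classes:
  fixes S :: "('a, 'm) ring_scheme set"
  assumes brace: "\<And>A. A \<in> S \<Longrightarrow> brace A"
    and fin: "\<And>A. A \<in> S \<Longrightarrow> finite (carrier A)"
    and card: "\<And>A. A \<in> S \<Longrightarrow> card (carrier A) = n"
  shows "finite (brace_iso_classes S)"
proof -
  let ?R = "{(A, B). A \<in> S \<and> B \<in> S \<and> brace_isomorphic A B}"
  let ?D = "{0..<n}"
  have "\<forall>A\<in>S. \<exists>e. bij_betw e ?D (carrier A)"
    using ex_bij_betw_nat_finite fin card by metis
  then obtain e where e: "bij_betw (e A) ?D (carrier A)" if "A \<in> S" for A
    by metis
  define i where "i A = inv_into ?D (e A)" for A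
  have i: "bij_betw (i A) (carrier A) ?D" if "A \<in> S" for A
    unfolding i_def by (rule bij_betw_inv_into[OF e[OF that]])
  have ei: "e A (i A x) = x" if "A \<in> S" "x \<in> carrier A" for A x
    unfolding i_def using bij_betw_inv_into_right[OF e] that by blast
  have eD: "e A s \<in> carrier A" if "A \<in> S" "s < n" for A s
    using bij_betwE[OF e] that by simp
  have iD: "i A x < n" if "A \<in> S" "x \<in> carrier A" for A x
    using bij_betwE[OF i] that by simp
  \<comment> \<open>Restriction to \<open>?D \<times> ?D\<close> makes a table an extensional
    function, so that it lies in the finite set \<open>?T\<close>.\<close>
  define tab where "tab A f = (\<lambda>(s, t)\<in>?D \<times> ?D. i A (f (e A s) (e A t)))"
    for A :: "('a, 'm) ring_scheme" and f
  define code where "code A = (tab A (add A), tab A (monoid.mult A))" for A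
  let ?T = "?D \<times> ?D \<rightarrow>\<^sub>E ?D"
  have code: "code A \<in> ?T \<times> ?T" if A: "A \<in> S" for A
  proof -
    interpret brace A by (rule brace[OF A])
    show ?thesis
      unfolding code_def tab_def by (auto simp: iD[OF A] eD[OF A])
  qed
  have tab: "tab A f (s, t) = i A (f (e A s) (e A t))" if "s < n" "t < n" for A f s t
    using that by (simp add: tab_def)
  have isom: "brace_isomorphic A B" if A: "A \<in> S" and B: "B \<in> S" and eq: "code A = code B" for A B
  proof -
    interpret A: brace A by (rule brace[OF A])
    interpret B: brace B by (rule brace[OF B])
    have pres: "e B (i A (f x y)) = g (e B (i A x)) (e B (i A y))"
      if "tab A f = tab B g" "x \<in> carrier A" "y \<in> carrier A"
        "g (e B (i A x)) (e B (i A y)) \<in> carrier B" for f g x y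
    proof -
      have "i A (f x y) = tab A f (i A x, i A y)"
        using that(2,3) A by (simp add: tab iD ei)
      also have "\<dots> = i B (g (e B (i A x)) (e B (i A y)))"
        using that A by (simp add: tab iD)
      finally show ?thesis
        using ei[OF B that(4)] by simp
    qed
    have eBi: "e B (i A x) \<in> carrier B" if "x \<in> carrier A" for x
      using that A B by (simp add: iD eD)
    \<comment> \<open>The isomorphism matches the elements that carry the same number.\<close>
    have "e B \<circ> i A \<in> brace_iso A B"
    proof (rule brace_isoI)
      show "bij_betw (e B \<circ> i A) (carrier A) (carrier B)"
        by (rule bij_betw_trans[OF i[OF A] e[OF B]])
    qed (use eq in \<open>auto simp: code_def eBi intro!: pres\<close>)
    then show ?thesis
      by (auto simp: brace_isomorphic_def)
  qed
  \<comment> \<open>The class of \<open>A\<close> is recovered from \<open>code A\<close> through a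
    chosen member of \<open>S\<close> with the same code, so the quotient is covered by an image of
    the set of codes.\<close>
  have "?R `` {A} = ?R `` {inv_into S code (code A)}" if A: "A \<in> S" for A
  proof -
    let ?B = "inv_into S code (code A)"
    have B: "?B \<in> S" "code ?B = code A"
      using A by (auto intro: inv_into_into f_inv_into_f)
    show ?thesis
      by (rule equiv_class_eq[OF equiv_brace_isomorphic[OF brace]]) (use A B isom in auto)
  qed
  then have "brace_iso_classes S \<subseteq> (\<lambda>c. ?R `` {inv_into S code c}) ` code ` S"
    unfolding brace_iso_classes_def quotient_def by blast
  moreover have "finite (code ` S)"
    by (rule finite_subset[of _ "?T \<times> ?T"]) (use code in \<open>blast intro: finite_PiE finite_cartesian_product\<close>, intro finite_cartesian_product finite_PiE, simp_all)
  ultimately show ?thesis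
    by (meson finite_imageI finite_subset)
qed

text \<open>Pairwise non-isomorphic members of \<open>S\<close> have distinct classes;
  \<open>fin\<close> turns this injection into an inequality of cardinalities.\<close>

lemma card_le_brace_iso_classes:
  fixes S :: "('a, 'm) ring_scheme set"
  assumes brace: "\<And>A. A \<in> S \<Longrightarrow> brace A"
    and fin: "finite (brace_iso_classes S)"
    and sub: "F ` I \<subseteq> S"
    and inj: "\<And>i j. i \<in> I \<Longrightarrow> j \<in> I \<Longrightarrow> brace_isomorphic (F i) (F j) \<Longrightarrow> i = j"
  shows "card I \<le> card (brace_iso_classes S)"
proof -
  let ?R = "{(A, B). A \<in> S \<and> B \<in> S \<and> brace_isomorphic A B}"
  have "inj_on (\<lambda>i. ?R `` {F i}) I"
  proof (rule inj_onI)
    fix i j assume "i \<in> I" "j \<in> I" "?R `` {F i} = ?R `` {F j}"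
    moreover from this have "(F i, F j) \<in> ?R"
      using sub eq_equiv_class[OF _ equiv_brace_isomorphic[OF brace]] by blast
    ultimately show "i = j"
      using inj by blast
  qed
  moreover have "(\<lambda>i. ?R `` {F i}) ` I \<subseteq> brace_iso_classes S"
    using sub unfolding brace_iso_classes_def by (blast intro: quotientI)
  ultimately show ?thesis
    using fin by (rule card_inj_on_le)
qed

subsection \<open>Recognising the modular maximal-cyclic group\<close>

text \<open>The homomorphism out of the free group that extends \<open>f\<close>, taken on words
  before cancellation is factored out.\<close>

definition (in group) word_eval :: "('g \<Rightarrow> 'a) \<Rightarrow> 'g word \<Rightarrow> 'a"
  where "word_eval f w = foldr (\<lambda>(x, e) r. (if e then f x else inv f x) \<otimes> r) w \<one>"

context group
begin

lemma word_eval_Nil [simp]: "word_eval f [] = \<one>"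
  and word_eval_Cons [simp]:
    "word_eval f ((x, e) # w) = (if e then f x else inv f x) \<otimes> word_eval f w"
  by (simp_all add: word_eval_def)

lemma word_eval_closed [simp]:
  assumes "\<And>x. f x \<in> carrier G"
  shows "word_eval f w \<in> carrier G"
  using assms by (induction w) auto

lemma word_eval_append:
  assumes "\<And>x. f x \<in> carrier G"
  shows "word_eval f (u @ v) = word_eval f u \<otimes> word_eval f v"
  using assms by (induction u) (auto simp: m_assoc)

lemma word_eval_replicate:
  assumes "\<And>x. f x \<in> carrier G"
  shows "word_eval f (replicate n (x, True)) = f x [^] n"
proof (induction n)
  case (Suc n)
  then show ?case
    using nat_pow_Suc2[OF assms] by simp
qed simp

text \<open>The universal property of a presentation: an assignment that satisfies the relations is
  constant on congruence classes, so it induces a map on the presented group.\<close>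

lemma word_eval_pres_cong:
  assumes "pres_cong R u v"
    and "\<And>x. f x \<in> carrier G"
    and "\<And>u v. (u, v) \<in> R \<Longrightarrow> word_eval f u = word_eval f v"
  shows "word_eval f u = word_eval f v"
  using assms(1)
proof (induction rule: pres_cong.induct)
  case (pres_append u v u' v')
  then show ?case using assms(2) by (simp add: word_eval_append)
next
  case (pres_cancel x e)
  then show ?case using assms(2) by (cases e) (simp_all)
qed (use assms(3) in auto)

lemma mult_pow_swap:
  assumes a: "a \<in> carrier G" and b: "b \<in> carrier G"
    and ba: "b \<otimes> a = a [^] (r::nat) \<otimes> b"
  shows "b \<otimes> a [^] (i::nat) = a [^] (r * i) \<otimes> b"
proof (induction i)
  case 0
  then show ?case using b by simp
next
  case (Suc i)
  have "b \<otimes> a [^] Suc i = (b \<otimes> a [^] i) \<otimes> a"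
    using a b by (simp add: m_assoc)
  also have "\<dots> = a [^] (r * i) \<otimes> (a [^] r \<otimes> b)"
    using a b by (simp add: Suc m_assoc ba)
  also have "\<dots> = a [^] (r * Suc i) \<otimes> b"
    using a b by (simp add: nat_pow_mult m_assoc[symmetric] add.commute)
  finally show ?case .
qed

text \<open>Inverse letters are replaced by \<open>a^(N-1)\<close> and \<open>b\<close>, and
  \<open>ba\<close> moves every \<open>b\<close> to the right of all \<open>a\<close>. The lemma
  later bounds the order of the presented group from above.\<close>

lemma word_eval_normal_form:
  fixes f :: "gen \<Rightarrow> 'a"
  assumes f: "\<And>x. f x \<in> carrier G"
    and N: "f GenA [^] (N::nat) = \<one>" "N > 0"
    and b2: "f GenB \<otimes> f GenB = \<one>"
    and ba: "f GenB \<otimes> f GenA = f GenA [^] (r::nat) \<otimes> f GenB"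
  shows "\<exists>i<N. \<exists>j<2. word_eval f w = f GenA [^] i \<otimes> f GenB [^] (j::nat)"
proof (induction w)
  case Nil
  show ?case
    using N(2) by (intro exI[of _ "0::nat"] conjI) simp_all
next
  case (Cons l w)
  let ?a = "f GenA" and ?b = "f GenB"
  \<comment> \<open>Exponents can be reduced modulo \<open>N\<close> and \<open>2\<close> at the
    end, so the induction step only has to produce some exponents.\<close>
  have red: "\<exists>i'<N. \<exists>j'<2. ?a [^] i \<otimes> ?b [^] j = ?a [^] i' \<otimes> ?b [^] (j'::nat)" for i j :: nat
  proof -
    have "?a [^] i = (?a [^] N) [^] (i div N) \<otimes> ?a [^] (i mod N)"
      using f by (simp add: nat_pow_mult nat_pow_pow)
    moreover have "?b [^] j = (?b [^] (2::nat)) [^] (j div 2) \<otimes> ?b [^] (j mod 2)"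
      using f by (simp add: nat_pow_mult nat_pow_pow)
    moreover have "?b [^] (2::nat) = \<one>"
      using f b2 by (simp add: numeral_2_eq_2)
    ultimately have "?a [^] i \<otimes> ?b [^] j = ?a [^] (i mod N) \<otimes> ?b [^] (j mod 2)"
      using f N by simp
    moreover have "i mod N < N" "j mod 2 < 2"
      using N by simp_all
    ultimately show ?thesis
      by blast
  qed
  obtain i j where ij: "word_eval f w = ?a [^] (i::nat) \<otimes> ?b [^] (j::nat)"
    using Cons.IH by (elim exE conjE) (rule that)
  obtain x e where l: "l = (x, e)" by fastforce
  have inv_b: "inv ?b = ?b"
    using b2 f by (simp add: inv_equality)
  have "?a [^] (N - 1) \<otimes> ?a = \<one>"
    using N by (metis Suc_diff_1 nat_pow_Suc)
  then have inv_a: "inv ?a = ?a [^] (N - 1)"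
    using f by (simp add: inv_equality)
  have mult_a: "?a [^] (n::nat) \<otimes> (?a [^] i \<otimes> ?b [^] j) = ?a [^] (n + i) \<otimes> ?b [^] j" for n
    using f by (simp add: nat_pow_mult m_assoc[symmetric])
  have "?b \<otimes> (?a [^] i \<otimes> ?b [^] j) = (?b \<otimes> ?a [^] i) \<otimes> ?b [^] j"
    using f by (simp add: m_assoc)
  also have "\<dots> = ?a [^] (r * i) \<otimes> (?b \<otimes> ?b [^] j)"
    using f mult_pow_swap[OF f f ba] by (simp add: m_assoc)
  finally have mult_b: "?b \<otimes> (?a [^] i \<otimes> ?b [^] j) = ?a [^] (r * i) \<otimes> ?b [^] Suc j"
    using f nat_pow_Suc2 by simp
  obtain i j where "word_eval f (l # w) = ?a [^] (i::nat) \<otimes> ?b [^] (j::nat)"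
  proof (cases x)
    case GenA
    then show ?thesis
      using mult_a[of 1] mult_a[of "N - 1"] f that[of "1 + i" j] that[of "N - 1 + i" j]
      by (cases e) (simp_all add: l ij inv_a)
  next
    case GenB
    then show ?thesis
      using mult_b that[of "r * i" "Suc j"] by (simp add: l ij inv_b)
  qed
  then show ?case
    using red by simp
qed

text \<open>Translates between the relation of the presentation and the commutation rule
  \<open>ba\<close>; the bracketing is the one that \<open>word_eval\<close> produces on a word of
  three letters.\<close>

lemma conjugate_eq_iff:
  assumes "x \<in> carrier G" "y \<in> carrier G" "z \<in> carrier G"
  shows "x \<otimes> (y \<otimes> inv x) = z \<longleftrightarrow> x \<otimes> y = z \<otimes> x"
proof -
  have "x \<otimes> (y \<otimes> inv x) = x \<otimes> y \<otimes> inv x"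
    using assms by (simp add: m_assoc)
  then show ?thesis
    using assms inv_solve_right'[of z "x \<otimes> y" x] by auto
qed

text \<open>The relations give a homomorphism \<open>h\<close> from the presented group onto the
  subgroup generated by \<open>a\<close> and \<open>b\<close>. Normal forms bound the presented
  group by \<open>2^(m+2)\<close> elements, and the \<open>2^(m+2)\<close> products
  \<open>a^i b^j\<close> are distinct in \<open>G\<close>, so \<open>h\<close> is bijective by
  counting. The hypothesis \<open>neq\<close> fixes the order of \<open>a\<close> and, through
  \<open>ba\<close>, prevents \<open>a\<close> and \<open>b\<close> from commuting.\<close>

lemma iso_modular_maximal_cyclic_group:
  assumes a: "a \<in> carrier G" and b: "b \<in> carrier G"
    and card: "card (carrier G) = 2 ^ (m + 2)"
    and a_pow: "a [^] (2 ^ (m + 1) :: nat) = \<one>"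
    and b2: "b \<otimes> b = \<one>"
    and ba: "b \<otimes> a = a [^] (1 + 2 ^ m :: nat) \<otimes> b"
    and neq: "a [^] (2 ^ m :: nat) \<noteq> \<one>"
  shows "G \<cong> modular_maximal_cyclic_group m"
proof -
  let ?N = "2 ^ (m + 1) :: nat"
  let ?R = "{(replicate ?N (GenA, True), []),
     ([(GenB, True), (GenB, True)], []),
     ([(GenB, True), (GenA, True), (GenB, False)], replicate (1 + 2 ^ m) (GenA, True))}"
  define R where "R = ?R"
  define P where "P = presented_group R"
  have R: "(replicate ?N (GenA, True), []) \<in> R" "([(GenB, True), (GenB, True)], []) \<in> R"
    "([(GenB, True), (GenA, True), (GenB, False)], replicate (1 + 2 ^ m) (GenA, True)) \<in> R"
    by (simp_all add: R_def)
  define f where "f = case_gen a b"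
  have f [simp]: "f x \<in> carrier G" "f GenA = a" "f GenB = b" for x
    using a b by (auto simp: f_def split: gen.split)
  have bab: "b \<otimes> (a \<otimes> inv b) = a [^] (1 + 2 ^ m :: nat)"
    using a b ba conjugate_eq_iff by simp
  interpret P: group P
    unfolding P_def by (rule group_presented_group)
  define g where "g x = word_class R [(x, True)]" for x
  have g [simp]: "g x \<in> carrier P" for x
    by (simp add: g_def P_def presented_group_def)
  have one: "\<one>\<^bsub>P\<^esub> = word_class R []"
    by (simp add: P_def presented_group_def)
  have g_inv: "inv\<^bsub>P\<^esub> g x = word_class R [(x, False)]" for x
  proof (rule P.inv_equality)
    show "word_class R [(x, False)] \<otimes>\<^bsub>P\<^esub> g x = \<one>\<^bsub>P\<^esub>"
      using pres_cancel[of R x False]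
      by (simp add: g_def P_def presented_group_mult word_class_eq_iff one[unfolded P_def])
    show "word_class R [(x, False)] \<in> carrier P"
      by (simp add: P_def presented_group_def)
  qed simp
  have P_eval: "word_class R w = P.word_eval g w" for w
  proof (induction w)
    case (Cons l w)
    obtain x e where l: "l = (x, e)" by fastforce
    have "word_class R (l # w) = word_class R [l] \<otimes>\<^bsub>P\<^esub> word_class R w"
      by (simp add: P_def presented_group_mult)
    then show ?case
      by (simp add: Cons l g_inv) (simp add: g_def)
  qed (simp add: one)
  have P_rel: "P.word_eval g u = P.word_eval g v" if "(u, v) \<in> R" for u v
    using pres_rel[OF that] by (simp only: P_eval[symmetric] word_class_eq_iff)
  have "g GenB \<otimes>\<^bsub>P\<^esub> (g GenA \<otimes>\<^bsub>P\<^esub> inv\<^bsub>P\<^esub> g GenB) = g GenA [^]\<^bsub>P\<^esub> (1 + 2 ^ m :: nat)"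
    using P_rel[OF R(3)]
    by (simp add: P.word_eval_replicate del: replicate.simps replicate_Suc)
  then have P_ba: "g GenB \<otimes>\<^bsub>P\<^esub> g GenA = g GenA [^]\<^bsub>P\<^esub> (1 + 2 ^ m :: nat) \<otimes>\<^bsub>P\<^esub> g GenB"
    using P.conjugate_eq_iff[of "g GenB" "g GenA"] by simp
  have sub: "carrier P \<subseteq> (\<lambda>(i, j). g GenA [^]\<^bsub>P\<^esub> i \<otimes>\<^bsub>P\<^esub> g GenB [^]\<^bsub>P\<^esub> j) ` ({..<?N} \<times> {..<2::nat})"
  proof
    fix U assume "U \<in> carrier P"
    then obtain w where "U = word_class R w"
      by (auto simp: P_def presented_group_def)
    then have U: "U = P.word_eval g w"
      using P_eval by simp
    have "\<exists>i<?N. \<exists>j<2. U = g GenA [^]\<^bsub>P\<^esub> i \<otimes>\<^bsub>P\<^esub> g GenB [^]\<^bsub>P\<^esub> (j::nat)"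
      unfolding U
    proof (rule P.word_eval_normal_form[where f = g and N = ?N and r = "1 + 2 ^ m"])
      show "g GenA [^]\<^bsub>P\<^esub> ?N = \<one>\<^bsub>P\<^esub>"
        using P_rel[OF R(1)] by (simp add: P.word_eval_replicate)
      show "g GenB \<otimes>\<^bsub>P\<^esub> g GenB = \<one>\<^bsub>P\<^esub>"
        using P_rel[OF R(2)] by simp
      show "g GenB \<otimes>\<^bsub>P\<^esub> g GenA = g GenA [^]\<^bsub>P\<^esub> (1 + 2 ^ m :: nat) \<otimes>\<^bsub>P\<^esub> g GenB"
        by (rule P_ba)
    qed simp_all
    then show "U \<in> (\<lambda>(i, j). g GenA [^]\<^bsub>P\<^esub> i \<otimes>\<^bsub>P\<^esub> g GenB [^]\<^bsub>P\<^esub> j) ` ({..<?N} \<times> {..<2::nat})"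
      by auto
  qed
  have finP: "finite (carrier P)"
    by (rule finite_subset[OF sub]) simp
  have "card (carrier P) \<le> card ({..<?N} \<times> {..<2::nat})"
    by (rule surj_card_le[OF _ sub]) simp
  then have cardP: "card (carrier P) \<le> card (carrier G)"
    by (simp add: card)
  \<comment> \<open>All words of a class have the same value, so the image is a singleton and
    \<open>the_elem\<close> extracts that value.\<close>
  define h where "h U = the_elem (word_eval f ` U)" for U
  have h: "h (word_class R w) = word_eval f w" for w
  proof -
    have "word_eval f v = word_eval f w" if "pres_cong R w v" for v
      using that
    proof (rule word_eval_pres_cong[symmetric])
      fix u v assume "(u, v) \<in> R"
      then show "word_eval f u = word_eval f v"
        using a b a_pow b2 bab
        by (auto simp: R_def word_eval_replicate simp del: replicate.simps replicate_Suc)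
    qed simp
    moreover have "w \<in> word_class R w"
      by (simp add: word_class_def pres_refl)
    ultimately have "word_eval f ` word_class R w = {word_eval f w}"
      unfolding word_class_def by blast
    then show ?thesis
      by (simp add: h_def)
  qed
  have P_carrier: "carrier P = range (word_class R)"
    by (simp add: P_def presented_group_def)
  have "h \<in> hom P G"
  proof (rule homI)
    fix U V assume "U \<in> carrier P" "V \<in> carrier P"
    then obtain u v where "U = word_class R u" "V = word_class R v"
      by (auto simp: P_carrier)
    then show "h (U \<otimes>\<^bsub>P\<^esub> V) = h U \<otimes> h V"
      by (simp add: P_def presented_group_mult h word_eval_append)
  qed (auto simp: P_carrier h)
  moreover have "bij_betw h (carrier P) (carrier G)"
  proof -
    let ?e = "\<lambda>(i, j). a [^] i \<otimes> b [^] j"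
    have "inj_on ?e ({..<?N} \<times> {..<2::nat})"
    proof -
      \<comment> \<open>A divisor of \<open>2^(m+1)\<close> that does not divide \<open>2^m\<close>
        is \<open>2^(m+1)\<close> itself.\<close>
      have ord_a: "ord a = ?N"
      proof -
        have "ord a dvd 2 ^ (m + 1)" "\<not> ord a dvd 2 ^ m"
          using a_pow neq pow_eq_id[OF a] by blast+
        then show ?thesis
          by (metis divides_primepow_nat le_imp_power_dvd le_Suc_eq two_is_prime_nat Suc_eq_plus1)
      qed
      have inj_a: "i = i'" if "a [^] i = a [^] i'" "i < ?N" "i' < ?N" for i i' :: nat
      proof -
        have "int ?N dvd int i' - int i"
          using that(1) int_pow_eq[OF a, of "int i" "int i'"] ord_a by (simp add: int_pow_int)
        then have "int (i' mod ?N) = int (i mod ?N)"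
          unfolding zmod_int by (simp only: mod_eq_dvd_iff)
        then show ?thesis
          using that by simp
      qed
      have noncomm: "b \<otimes> a \<noteq> a \<otimes> b"
      proof
        assume "b \<otimes> a = a \<otimes> b"
        then have "a [^] (1 + 2 ^ m :: nat) = a"
          using a b ba by (metis nat_pow_closed r_cancel)
        then have "a \<otimes> a [^] (2 ^ m :: nat) = a \<otimes> \<one>"
          using a by (metis nat_pow_mult nat_pow_eone r_one)
        then show False
          using a neq by (metis nat_pow_closed l_cancel one_closed)
      qed
      \<comment> \<open>Otherwise \<open>b\<close> would be a power of \<open>a\<close> and commute
        with it.\<close>
      have b_notin: "a [^] i \<noteq> a [^] i' \<otimes> b" for i i' :: nat
      proof
        assume "a [^] i = a [^] i' \<otimes> b"
        then have "b = inv (a [^] i') \<otimes> a [^] i"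
          using a b by (metis inv_solve_left nat_pow_closed)
        then have "b = a [^] (int i - int i')"
          using a by (simp add: int_pow_diff int_pow_int)
            (metis int_pow_int int_pow_mult int_pow_neg add.commute)
        then show False
          using noncomm a by (metis int_pow_mult int_pow_1 add.commute)
      qed
      show ?thesis
      proof (rule inj_onI)
        fix p q
        assume pq: "p \<in> {..<?N} \<times> {..<2::nat}" "q \<in> {..<?N} \<times> {..<2::nat}" "?e p = ?e q"
        obtain i j i' j' where p: "p = (i, j)" and q: "q = (i', j')"
          by fastforce
        have *: "i \<in> {..<?N}" "i' \<in> {..<?N}" "j \<in> {..<2}" "j' \<in> {..<2}"
          and eq: "a [^] i \<otimes> b [^] j = a [^] i' \<otimes> b [^] j'"
          using pq by (auto simp: p q)
        have "j = 0 \<or> j = 1" "j' = 0 \<or> j' = 1"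
          using * by auto
        then have "j = j'"
          using eq b_notin[of i i'] b_notin[of i' i] a b by auto
        moreover from this have "a [^] i = a [^] i'"
          using eq a b by (metis nat_pow_closed r_cancel)
        ultimately show "p = q"
          using inj_a * by (simp add: p q)
      qed
    qed
    then have card_e: "card (?e ` ({..<?N} \<times> {..<2::nat})) = card (carrier G)"
      by (simp add: card_image card)
    have e_sub: "?e ` ({..<?N} \<times> {..<2::nat}) \<subseteq> h ` carrier P"
    proof clarify
      fix i j
      have "a [^] i \<otimes> b [^] j = h (word_class R (replicate i (GenA, True) @ replicate j (GenB, True)))"
        by (simp add: h word_eval_append word_eval_replicate)
      then show "a [^] i \<otimes> b [^] j \<in> h ` carrier P"
        by (auto simp: P_carrier)
    qed
    have h_sub: "h ` carrier P \<subseteq> carrier G"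
      by (auto simp: P_carrier h)
    have "finite (carrier G)"
      using card by (intro card_ge_0_finite) simp
    moreover have "card (carrier G) \<le> card (h ` carrier P)"
      unfolding card_e[symmetric] using finP e_sub by (intro card_mono) simp_all
    \<comment> \<open>The image of \<open>h\<close> contains as many elements as \<open>G\<close>
      has; with \<open>cardP\<close>, surjectivity then forces injectivity.\<close>
    ultimately have surj: "h ` carrier P = carrier G"
      using h_sub by (intro card_seteq) simp_all
    have "card (h ` carrier P) = card (carrier P)"
      using surj cardP card_image_le[OF finP, of h] by simp
    then have "inj_on h (carrier P)"
      by (rule eq_card_imp_inj_on[OF finP])
    then show ?thesis
      using surj by (simp add: bij_betw_def)
  qed
  ultimately have "P \<cong> G"
    by (auto simp: is_iso_def iso_def)
  then show ?thesis
    unfolding modular_maximal_cyclic_group_def R_def[symmetric] P_def[symmetric] by (rule P.iso_sym)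
qed

end

subsection \<open>A family of braces\<close>

text \<open>The pair \<open>(x, y)\<close> in \<open>\<int>/2^(m+1) \<times> \<int>/2\<close> is coded by the number \<open>2 x + y\<close> for reduced
  representatives.\<close>

definition enc :: "nat \<Rightarrow> int \<Rightarrow> int \<Rightarrow> nat"
  where "enc m x y = nat (2 * (x mod 2 ^ (m + 1)) + y mod 2)"

lemma int_enc: "int (enc m x y) = 2 * (x mod 2 ^ (m + 1)) + y mod 2"
  unfolding enc_def by simp

lemma enc_div: "int (enc m x y div 2) = x mod 2 ^ (m + 1)"
  and enc_mod: "int (enc m x y mod 2) = y mod 2"
  by (simp_all add: zdiv_int zmod_int int_enc del: of_nat_mod of_nat_div power_Suc)

lemma enc_less: "enc m x y < 2 ^ (m + 2)"
proof -
  have "x mod 2 ^ (m + 1) < 2 ^ (m + 1)" "y mod 2 < 2"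
    by (rule pos_mod_bound, simp)+
  then have "int (enc m x y) < 2 * 2 ^ (m + 1)"
    unfolding int_enc by linarith
  also have "\<dots> = int (2 ^ (m + 2))"
    by simp
  finally show ?thesis
    by (simp only: of_nat_less_iff)
qed

lemma enc_eq_iff:
  "enc m x y = enc m x' y' \<longleftrightarrow> 2 ^ (m + 1) dvd x - x' \<and> 2 dvd y - y'"
  by (metis enc_def enc_div enc_mod mod_eq_dvd_iff)

lemma enc_surj:
  assumes "s < 2 ^ (m + 2)"
  shows "enc m (int (s div 2)) (int (s mod 2)) = s"
proof -
  have "s div 2 < 2 ^ (m + 1)"
    using assms by (simp add: less_mult_imp_div_less)
  then have "int (s div 2) < int (2 ^ (m + 1))"
    by (simp only: of_nat_less_iff)
  then have "int (s div 2) mod 2 ^ (m + 1) = int (s div 2)"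
    by (intro mod_pos_pos_trivial) simp_all
  then have "int (enc m (int (s div 2)) (int (s mod 2))) = int (2 * (s div 2) + s mod 2)"
    unfolding int_enc of_nat_add by simp
  then show ?thesis
    by (simp only: of_nat_eq_iff mult_div_mod_eq)
qed

text \<open>The two components of the product as integer polynomials; since \<open>x' (x' - 1)\<close> is even, the
  last term of the first one is \<open>2^m c x binom(x', 2)\<close>. It makes the action of \<open>(x', y')\<close> on the left
  argument multiplicative although the second component contains \<open>c x x'\<close>.\<close>

definition circ1 :: "nat \<Rightarrow> nat \<Rightarrow> int \<Rightarrow> int \<Rightarrow> int \<Rightarrow> int \<Rightarrow> int \<Rightarrow> int \<Rightarrow> int"
  where "circ1 m k c d x y x' y' = x + x' + 2 ^ k * x * x'
    + 2 ^ m * (d * x * y' + (1 - d) * x' * y) + c * 2 ^ (m - 1) * x * x' * (x' - 1)"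

definition circ2 :: "int \<Rightarrow> int \<Rightarrow> int \<Rightarrow> int \<Rightarrow> int \<Rightarrow> int"
  where "circ2 c x y x' y' = y + y' + c * x * x'"

text \<open>Additively this is \<int>/2^(m+1) \<times> \<int>/2. The entries \<open>zero\<close> and
  \<open>one\<close> agree, as they do in every brace.\<close>

definition mmc_brace :: "nat \<Rightarrow> nat \<Rightarrow> int \<Rightarrow> int \<Rightarrow> nat ring"
  where "mmc_brace m k c d =
    \<lparr>carrier = {..<2 ^ (m + 2)},
     monoid.mult = (\<lambda>s t. enc m
       (circ1 m k c d (int (s div 2)) (int (s mod 2)) (int (t div 2)) (int (t mod 2)))
       (circ2 c (int (s div 2)) (int (s mod 2)) (int (t div 2)) (int (t mod 2)))),
     one = enc m 0 0,
     ring.zero = enc m 0 0,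
     ring.add = (\<lambda>s t. enc m (int (s div 2) + int (t div 2)) (int (s mod 2) + int (t mod 2)))\<rparr>"

lemma mmc_brace_carrier: "carrier (mmc_brace m k c d) = {..<2 ^ (m + 2)}"
  and mmc_brace_zero: "\<zero>\<^bsub>mmc_brace m k c d\<^esub> = enc m 0 0"
  and mmc_brace_one: "\<one>\<^bsub>mmc_brace m k c d\<^esub> = enc m 0 0"
  by (simp_all add: mmc_brace_def)

lemma enc_carrier: "enc m x y \<in> carrier (mmc_brace m k c d)"
  unfolding mmc_brace_carrier using enc_less by blast

lemma mmc_brace_cases:
  assumes "s \<in> carrier (mmc_brace m k c d)"
  obtains x y where "s = enc m x y"
  using assms enc_surj[of s m, symmetric] by (auto simp: mmc_brace_carrier)

lemma mmc_brace_add: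
  "enc m x y \<oplus>\<^bsub>mmc_brace m k c d\<^esub> enc m x' y' = enc m (x + x') (y + y')"
  by (simp add: mmc_brace_def enc_div enc_mod enc_eq_iff mod_add_eq flip: mod_eq_dvd_iff
      del: of_nat_mod of_nat_div power_Suc)

section \<open>The brace axioms for the family\<close>

locale mmc_params =
  fixes m k :: nat and c d :: int
  assumes k: "2 \<le> k" "k \<le> m" and m: "3 \<le> m"
begin

abbreviation "A \<equiv> mmc_brace m k c d"
abbreviation "e \<equiv> enc m"
abbreviation "f \<equiv> circ1 m k c d"
abbreviation "g \<equiv> circ2 c"

text \<open>With \<open>R = 2^(m-3)\<close> and \<open>P = 2^(k-2)\<close>, the congruences below
  become polynomial identities over the integers with a visible factor \<open>16 * R\<close> or
  \<open>2\<close>. The bounds on \<open>m\<close> and \<open>k\<close> supply the factors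
  \<open>4\<close>.\<close>

lemma powers:
  obtains P R :: int
  where "(2 :: int) ^ (m + 1) = 16 * R" "(2 :: int) ^ m = 8 * R"
    "(2 :: int) ^ (m - 1) = 4 * R" "(2 :: int) ^ k = 4 * P"
proof -
  obtain m' k' where "m = m' + 3" "k = k' + 2"
    using k(1) m by (metis le_add_diff_inverse2)
  then show thesis
    using that[of "2 ^ m'" "2 ^ k'"] by (simp add: power_add)
qed

text \<open>The product is well defined on residue classes, so later computations may use arbitrary
  integer representatives.\<close>

lemma circ_cong:
  assumes "2 ^ (m + 1) dvd x - u" "2 dvd y - v" "2 ^ (m + 1) dvd x' - u'" "2 dvd y' - v'"
  shows "e (f x y x' y') (g x y x' y') = e (f u v u' v') (g u v u' v')"
proof -
  obtain P R where pow: "(2 :: int) ^ (m + 1) = 16 * R" "(2 :: int) ^ m = 8 * R"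
      "(2 :: int) ^ (m - 1) = 4 * R" "(2 :: int) ^ k = 4 * P"
    by (rule powers)
  obtain i i' j j' where "x - u = 16 * R * i" "x' - u' = 16 * R * i'" "y - v = 2 * j" "y' - v' = 2 * j'"
    using assms unfolding pow by (elim dvdE) (rule that)
  then have *: "x = u + 16 * R * i" "x' = u' + 16 * R * i'" "y = v + 2 * j" "y' = v' + 2 * j'"
    by simp_all
  have "f x y x' y' - f u v u' v' = 16 * R * (i + i' + 4 * P * (i * u' + u * i' + 16 * R * i * i')
      + d * (8 * R * i * (v' + 2 * j') + u * j') + (1 - d) * (8 * R * i' * (v + 2 * j) + u' * j)
      + 4 * R * c * (i * x' * (x' - 1) + u * i' * (2 * u' + 16 * R * i' - 1)))"
    unfolding circ1_def pow * by (simp add: algebra_simps power2_eq_square)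
  moreover have "g x y x' y' - g u v u' v' = 2 * (j + j' + c * 8 * R * (i * u' + u * i' + 16 * R * i * i'))"
    unfolding circ2_def * by (simp add: algebra_simps power2_eq_square)
  ultimately show ?thesis
    unfolding enc_eq_iff pow by (metis dvd_triv_left)
qed

lemma brace_mult: "e x y \<otimes>\<^bsub>A\<^esub> e x' y' = e (f x y x' y') (g x y x' y')"
proof -
  have "e x y \<otimes>\<^bsub>A\<^esub> e x' y' = e
      (f (x mod 2 ^ (m + 1)) (y mod 2) (x' mod 2 ^ (m + 1)) (y' mod 2))
      (g (x mod 2 ^ (m + 1)) (y mod 2) (x' mod 2 ^ (m + 1)) (y' mod 2))"
    by (simp add: mmc_brace_def enc_div enc_mod del: of_nat_mod of_nat_div power_Suc)
  also have "\<dots> = e (f x y x' y') (g x y x' y')"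
    by (rule circ_cong) (simp_all flip: mod_eq_dvd_iff del: power_Suc)
  finally show ?thesis .
qed

lemma mult_assoc:
  "e (f (f x1 y1 x2 y2) (g x1 y1 x2 y2) x3 y3) (g (f x1 y1 x2 y2) (g x1 y1 x2 y2) x3 y3)
    = e (f x1 y1 (f x2 y2 x3 y3) (g x2 y2 x3 y3)) (g x1 y1 (f x2 y2 x3 y3) (g x2 y2 x3 y3))"
proof -
  obtain P R where pow: "(2 :: int) ^ (m + 1) = 16 * R" "(2 :: int) ^ m = 8 * R"
      "(2 :: int) ^ (m - 1) = 4 * R" "(2 :: int) ^ k = 4 * P"
    by (rule powers)
  \<comment> \<open>The part \<open>x + x' + 4 * P * x * x'\<close> is associative over the
    integers; \<open>F\<close> collects the remaining terms, all of which carry a factor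
    \<open>R\<close>.\<close>
  define F where "F x y x' y' = 2 * (d * x * y' + (1 - d) * x' * y) + c * x * x' * (x' - 1)" for x y x' y'
  define E where "E x y x' y' = P * x * x' + R * F x y x' y'" for x y x' y'
  have f: "f x y x' y' = x + x' + 4 * E x y x' y'" for x y x' y'
    unfolding circ1_def E_def F_def pow by (simp add: algebra_simps power2_eq_square)
  let ?e12 = "E x1 y1 x2 y2" and ?e23 = "E x2 y2 x3 y3"
  \<comment> \<open>The binomial terms leave \<open>- 8 * R * c * x1 * x2 * x3\<close>, and the
    products in the second components add \<open>8 * R * c * (1 - 2 * d) * x1 * x2 * x3\<close>.
    Only together are they divisible by \<open>16 * R\<close>; their sum is the last term in the
    bracket.\<close>
  have "f (f x1 y1 x2 y2) (g x1 y1 x2 y2) x3 y3 - f x1 y1 (f x2 y2 x3 y3) (g x2 y2 x3 y3)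
    = 16 * R * (P * (F x1 y1 x2 y2 * x3 - x1 * F x2 y2 x3 y3)
      + 2 * d * ?e12 * y3 - 2 * (1 - d) * ?e23 * y1 + c * ?e12 * x3 * (x3 - 1)
      - c * x1 * (2 * (x2 + x3) * ?e23 + 4 * ?e23\<^sup>2 - ?e23) - c * d * x1 * x2 * x3)"
    unfolding f[of x1 y1 x2 y2] f[of x2 y2 x3 y3] circ1_def circ2_def pow
    unfolding E_def F_def by (simp add: algebra_simps power2_eq_square)
  moreover have "g (f x1 y1 x2 y2) (g x1 y1 x2 y2) x3 y3 - g x1 y1 (f x2 y2 x3 y3) (g x2 y2 x3 y3)
    = 2 * (2 * c * (?e12 * x3 - x1 * ?e23))"
    unfolding f circ2_def by (simp add: algebra_simps power2_eq_square)
  ultimately show ?thesis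
    unfolding enc_eq_iff pow by (metis dvd_triv_left)
qed

text \<open>Choosing \<open>y\<close> to annul the second component makes the first one affine in
  \<open>x\<close>, of the form \<open>x * U + t\<close>. Since \<open>U\<close> is odd, it is
  invertible modulo \<open>2^(m+1)\<close>.\<close>

lemma left_inverse: "\<exists>x y. e (f x y x' y') (g x y x' y') = e 0 0"
proof -
  obtain P R where pow: "(2 :: int) ^ (m + 1) = 16 * R" "(2 :: int) ^ m = 8 * R"
      "(2 :: int) ^ (m - 1) = 4 * R" "(2 :: int) ^ k = 4 * P"
    by (rule powers)
  define U where "U = 1 + 2 ^ k * x' + 2 ^ m * d * y' + c * 2 ^ (m - 1) * x' * (x' - 1)
    - (1 - d) * c * 2 ^ m * x' * x'"
  have "U = 1 + 2 * (2 * P * x' + 4 * R * d * y' + 2 * c * R * x' * (x' - 1)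
      - 4 * (1 - d) * c * R * x' * x')"
    unfolding U_def pow by (simp add: algebra_simps power2_eq_square)
  then have "odd U"
    by simp
  then have "coprime U (2 ^ (m + 1))"
    by simp
  then obtain w v where w: "w * U + v * 2 ^ (m + 1) = 1"
    using bezout_int[of U "2 ^ (m + 1)"] by auto
  define t where "t = x' - (1 - d) * 2 ^ m * x' * y'"
  define x where "x = - w * t"
  define y where "y = - y' - c * x * x'"
  have "f x y x' y' = x * U + t"
    unfolding circ1_def U_def y_def t_def by (simp add: algebra_simps power2_eq_square)
  also have "\<dots> = (1 - w * U) * t"
    unfolding x_def by (simp add: algebra_simps)
  also have "1 - w * U = v * 2 ^ (m + 1)"
    using w by simp
  finally have "e (f x y x' y') (g x y x' y') = e 0 0"
    unfolding enc_eq_iff by (simp add: circ2_def y_def)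
  then show ?thesis by blast
qed

lemma group_mmc_brace: "group A"
proof (rule groupI)
  fix s t u assume "s \<in> carrier A" "t \<in> carrier A" "u \<in> carrier A"
  then show "s \<otimes>\<^bsub>A\<^esub> t \<otimes>\<^bsub>A\<^esub> u = s \<otimes>\<^bsub>A\<^esub> (t \<otimes>\<^bsub>A\<^esub> u)"
    by (elim mmc_brace_cases) (simp add: brace_mult mult_assoc)
next
  fix s assume "s \<in> carrier A"
  then show "\<exists>t\<in>carrier A. t \<otimes>\<^bsub>A\<^esub> s = \<one>\<^bsub>A\<^esub>"
    by (elim mmc_brace_cases)
      (metis brace_mult enc_carrier left_inverse mmc_brace_one)
qed (auto elim!: mmc_brace_cases simp: enc_carrier mmc_brace_one brace_mult circ1_def circ2_def)

lemma abelian_group_mmc_brace: "abelian_group A"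
proof (rule abelian_groupI)
  fix s assume "s \<in> carrier A"
  then obtain x y where "s = e x y"
    by (rule mmc_brace_cases)
  then have "e (- x) (- y) \<oplus>\<^bsub>A\<^esub> s = \<zero>\<^bsub>A\<^esub>"
    by (simp add: mmc_brace_add mmc_brace_zero)
  then show "\<exists>t\<in>carrier A. t \<oplus>\<^bsub>A\<^esub> s = \<zero>\<^bsub>A\<^esub>"
    using enc_carrier by blast
qed (auto elim!: mmc_brace_cases simp: enc_carrier mmc_brace_zero mmc_brace_add ac_simps)

lemma brace_mmc_brace: "brace A"
proof (intro brace.intro brace_axioms.intro abelian_group_mmc_brace group_mmc_brace)
  fix s t u assume "s \<in> carrier A" "t \<in> carrier A" "u \<in> carrier A"
  then obtain x y x' y' x'' y'' where "s = e x y" "t = e x' y'" "u = e x'' y''"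
    by (elim mmc_brace_cases)
  then show "(t \<oplus>\<^bsub>A\<^esub> u) \<otimes>\<^bsub>A\<^esub> s \<oplus>\<^bsub>A\<^esub> s = t \<otimes>\<^bsub>A\<^esub> s \<oplus>\<^bsub>A\<^esub> u \<otimes>\<^bsub>A\<^esub> s"
    by (simp add: brace_mult mmc_brace_add circ1_def circ2_def algebra_simps)
qed

section \<open>The adjoint group\<close>

text \<open>Squaring doubles the first component up to an odd factor, so its 2-adic valuation grows
  by exactly one. The second component becomes \<open>2 * y + c * x * x\<close>, which is even from
  the second squaring on, when \<open>x\<close> is already even.\<close>

lemma pow_two_power:
  "\<exists>z y. odd z \<and> (1 \<le> i \<longrightarrow> even y) \<and> e 1 0 [^]\<^bsub>A\<^esub> (2 ^ Suc i :: nat) = e (2 ^ Suc i * z) y"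
proof -
  obtain P R where pow: "(2 :: int) ^ (m + 1) = 16 * R" "(2 :: int) ^ m = 8 * R"
      "(2 :: int) ^ (m - 1) = 4 * R" "(2 :: int) ^ k = 4 * P"
    by (rule powers)
  interpret group A by (rule group_mmc_brace)
  have square: "\<exists>z' y'. odd z' \<and> (1 \<le> j \<longrightarrow> even y')
      \<and> e 1 0 [^]\<^bsub>A\<^esub> (2 ^ Suc j :: nat) = e (2 ^ Suc j * z') y'"
    if "odd z" "e 1 0 [^]\<^bsub>A\<^esub> (2 ^ j :: nat) = e (2 ^ j * z) y" for j z y
  proof (intro exI conjI)
    let ?x = "2 ^ j * z"
    define z' where "z' = z * (1 + 2 * (P * ?x + 2 * R * y + c * R * ?x * (?x - 1)))"
    show "odd z'"
      using that(1) by (simp add: z'_def)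
    show "1 \<le> j \<longrightarrow> even (2 * y + c * ?x * ?x)"
      by simp
    have "e 1 0 [^]\<^bsub>A\<^esub> (2 ^ Suc j :: nat) = e 1 0 [^]\<^bsub>A\<^esub> (2 ^ j :: nat) \<otimes>\<^bsub>A\<^esub> e 1 0 [^]\<^bsub>A\<^esub> (2 ^ j :: nat)"
      by (simp add: nat_pow_mult enc_carrier mult_2)
    also have "\<dots> = e (f ?x y ?x y) (g ?x y ?x y)"
      unfolding that by (rule brace_mult)
    also have "f ?x y ?x y = 2 ^ Suc j * z'"
      unfolding circ1_def pow z'_def by (simp add: algebra_simps)
    also have "g ?x y ?x y = 2 * y + c * ?x * ?x"
      unfolding circ2_def by simp
    finally show "e 1 0 [^]\<^bsub>A\<^esub> (2 ^ Suc j :: nat) = e (2 ^ Suc j * z') (2 * y + c * ?x * ?x)" .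
  qed
  show ?thesis
  proof (induction i)
    case 0
    show ?case
      using square[of 1 0 0] by (simp add: enc_carrier)
  next
    case (Suc i)
    then show ?case
      using square by blast
  qed
qed

text \<open>An odd multiple of \<open>2^m\<close> is congruent to \<open>2^m\<close> modulo
  \<open>2^(m+1)\<close>, and enough squarings have occurred for the second component to
  vanish.\<close>

lemma pow_half: "e 1 0 [^]\<^bsub>A\<^esub> (2 ^ m :: nat) = e (2 ^ m) 0"
proof -
  obtain j where j: "m = Suc j" "1 \<le> j"
    using m by (cases m) auto
  obtain z y where z: "odd z" "even y" "e 1 0 [^]\<^bsub>A\<^esub> (2 ^ m :: nat) = e (2 ^ m * z) y"
    using pow_two_power[of j] j by auto
  obtain n where "z = 2 * n + 1"
    using z(1) by (rule oddE)
  then have "2 ^ m * z - 2 ^ m = 2 ^ (m + 1) * n"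
    by (simp add: algebra_simps)
  then show ?thesis
    using z by (simp add: enc_eq_iff)
qed

lemma iso_mmc_group: "A \<cong> modular_maximal_cyclic_group m"
proof -
  obtain P R where pow: "(2 :: int) ^ (m + 1) = 16 * R" "(2 :: int) ^ m = 8 * R"
      "(2 :: int) ^ (m - 1) = 4 * R" "(2 :: int) ^ k = 4 * P"
    by (rule powers)
  interpret group A by (rule group_mmc_brace)
  show ?thesis
  proof (rule iso_modular_maximal_cyclic_group)
    show "e 1 0 \<in> carrier A" "e 0 1 \<in> carrier A"
      by (rule enc_carrier)+
    show "card (carrier A) = 2 ^ (m + 2)"
      by (simp add: mmc_brace_carrier)
    obtain z y where z: "even y" "e 1 0 [^]\<^bsub>A\<^esub> (2 ^ Suc m :: nat) = e (2 ^ Suc m * z) y"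
      using pow_two_power[of m] m by auto
    then show "e 1 0 [^]\<^bsub>A\<^esub> (2 ^ (m + 1) :: nat) = \<one>\<^bsub>A\<^esub>"
      by (simp add: mmc_brace_one enc_eq_iff)
    show "e 0 1 \<otimes>\<^bsub>A\<^esub> e 0 1 = \<one>\<^bsub>A\<^esub>"
      by (simp add: brace_mult mmc_brace_one enc_eq_iff circ1_def circ2_def)
    show "e 1 0 [^]\<^bsub>A\<^esub> (2 ^ m :: nat) \<noteq> \<one>\<^bsub>A\<^esub>"
      by (simp add: pow_half mmc_brace_one enc_eq_iff)
    have "e 1 0 [^]\<^bsub>A\<^esub> (1 + 2 ^ m :: nat) = e (2 ^ m) 0 \<otimes>\<^bsub>A\<^esub> e 1 0"
      using pow_half by (simp add: enc_carrier)
    also have "\<dots> \<otimes>\<^bsub>A\<^esub> e 0 1 = e 0 1 \<otimes>\<^bsub>A\<^esub> e 1 0"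
    proof -
      \<comment> \<open>The left product collects \<open>2^m\<close> and \<open>2^m * d\<close>, the
        right one \<open>2^m * (1 - d)\<close>; this accounts for the summand \<open>d\<close> in
        the quotient.\<close>
      have "f (f (2 ^ m) 0 1 0) (g (2 ^ m) 0 1 0) 0 1 - f 0 1 1 0
          = 16 * R * (d + 2 * P + 4 * R * d + 16 * P * R * d)"
        unfolding circ1_def circ2_def pow by (simp add: algebra_simps)
      moreover have "g (f (2 ^ m) 0 1 0) (g (2 ^ m) 0 1 0) 0 1 - g 0 1 1 0 = 2 * (4 * R * c)"
        unfolding circ1_def circ2_def pow by (simp add: algebra_simps)
      ultimately show ?thesis
        unfolding brace_mult enc_eq_iff pow by (metis dvd_triv_left)
    qed
    finally show "e 0 1 \<otimes>\<^bsub>A\<^esub> e 1 0 = e 1 0 [^]\<^bsub>A\<^esub> (1 + 2 ^ m :: nat) \<otimes>\<^bsub>A\<^esub> e 0 1"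
      by simp
  qed
qed

section \<open>The additive group\<close>

lemma add_pow_enc: "e x y [^]\<^bsub>add_monoid A\<^esub> (n::nat) = e (int n * x) (int n * y)"
proof -
  interpret abelian_group A by (rule abelian_group_mmc_brace)
  show ?thesis
    by (induction n) (simp_all add: a_group[THEN group.is_monoid] monoid.nat_pow_0 monoid.nat_pow_Suc
      mmc_brace_zero mmc_brace_add algebra_simps)
qed

text \<open>The exponent of the additive group divides \<open>2^(m+1)\<close>, whereas a generator
  would have order \<open>2^(m+2)\<close>.\<close>

lemma not_cyclic_add: "\<not> cyclic_group (add_monoid A)"
proof
  interpret add: group "add_monoid A"
    by (rule abelian_group.a_group[OF abelian_group_mmc_brace])
  assume "cyclic_group (add_monoid A)"
  then obtain s where s: "s \<in> carrier (add_monoid A)"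
    and gen: "carrier (add_monoid A) = range (\<lambda>n::int. s [^]\<^bsub>add_monoid A\<^esub> n)"
    unfolding add.cyclic_group by blast
  have "carrier (add_monoid A) = generate (add_monoid A) {s}"
    unfolding add.generate_pow[OF s] using gen by auto
  then have "card (carrier A) = add.ord s"
    using add.generate_pow_card[OF s] by simp
  moreover have "add.ord s dvd 2 ^ (m + 1)"
  proof -
    obtain x y where "s = e x y"
      using s by (auto elim: mmc_brace_cases)
    then have "s [^]\<^bsub>add_monoid A\<^esub> (2 ^ (m + 1) :: nat)
        = e (int (2 ^ (m + 1)) * x) (int (2 ^ (m + 1)) * y)"
      using add_pow_enc by blast
    also have "\<dots> = \<one>\<^bsub>add_monoid A\<^esub>"
      by (simp add: mmc_brace_zero enc_eq_iff)
    finally show ?thesis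
      using add.pow_eq_id[OF s] by blast
  qed
  then have "add.ord s \<le> 2 ^ (m + 1)"
    by (rule dvd_imp_le) simp
  ultimately show False
    by (simp add: mmc_brace_carrier)
qed

lemma mmc_brace_in: "A \<in> noncyclic_mmc_braces m"
  unfolding noncyclic_mmc_braces_def modular_maximal_cyclic_brace_def
  using brace_mmc_brace iso_mmc_group not_cyclic_add by blast

end

subsection \<open>Invariants\<close>

text \<open>If \<open>s \<circ> t = s + t + r\<close>, then \<open>r\<close> is the product \<open>s * t\<close> of the brace.\<close>

definition star_annihilated :: "nat \<Rightarrow> 'a ring \<Rightarrow> bool"
  where "star_annihilated n A \<longleftrightarrow> (\<forall>s\<in>carrier A. \<forall>t\<in>carrier A. \<forall>r\<in>carrier A.
    s \<otimes>\<^bsub>A\<^esub> t = s \<oplus>\<^bsub>A\<^esub> t \<oplus>\<^bsub>A\<^esub> r \<longrightarrow> r [^]\<^bsub>add_monoid A\<^esub> n = \<zero>\<^bsub>A\<^esub>)"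

definition star_doubled :: "'a ring \<Rightarrow> bool"
  where "star_doubled A \<longleftrightarrow> (\<forall>s\<in>carrier A. \<forall>t\<in>carrier A. \<exists>r\<in>carrier A.
    s \<otimes>\<^bsub>A\<^esub> t = s \<oplus>\<^bsub>A\<^esub> t \<oplus>\<^bsub>A\<^esub> (r \<oplus>\<^bsub>A\<^esub> r))"

definition has_annihilating_involution :: "'a ring \<Rightarrow> bool"
  where "has_annihilating_involution A \<longleftrightarrow> (\<exists>s\<in>carrier A. s \<oplus>\<^bsub>A\<^esub> s = \<zero>\<^bsub>A\<^esub>
    \<and> (\<forall>r\<in>carrier A. s \<noteq> r \<oplus>\<^bsub>A\<^esub> r) \<and> (\<forall>t\<in>carrier A. s \<otimes>\<^bsub>A\<^esub> t = s \<oplus>\<^bsub>A\<^esub> t))"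

text \<open>Each property is phrased by elements and the two operations. One-sided implications
  suffice, since the lemma is also applied to the inverse isomorphism; the first goes from
  \<open>B\<close> to \<open>A\<close> because elements of \<open>A\<close> are pushed forward along
  \<open>f\<close>.\<close>

lemma brace_iso_invariants:
  assumes A: "brace A" and B: "brace B" and iso: "brace_isomorphic A B"
  shows "star_annihilated n B \<Longrightarrow> star_annihilated n A"
    and "star_doubled A \<Longrightarrow> star_doubled B"
    and "has_annihilating_involution A \<Longrightarrow> has_annihilating_involution B"
proof -
  interpret A: brace A by fact
  interpret B: brace B by fact
  obtain f where f: "f \<in> brace_iso A B"
    using iso by (auto simp: brace_isomorphic_def)
  note add = brace_isoD(2)[OF f] and mult = brace_isoD(3)[OF f]
  have im: "carrier B = f ` carrier A" and inj: "inj_on f (carrier A)"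
    using brace_isoD(1)[OF f] by (auto simp: bij_betw_def)
  have closed: "f s \<in> carrier B" if "s \<in> carrier A" for s
    using that im by blast
  have eq: "f s = f t \<longleftrightarrow> s = t" if "s \<in> carrier A" "t \<in> carrier A" for s t
    using inj_on_eq_iff[OF inj that] .
  have hom: "f \<in> hom (add_monoid A) (add_monoid B)"
    using f by (simp add: brace_iso_def iso_def)
  have zero: "f \<zero>\<^bsub>A\<^esub> = \<zero>\<^bsub>B\<^esub>"
    using hom_one[OF hom A.a_group B.a_group] by simp
  have pow: "f (s [^]\<^bsub>add_monoid A\<^esub> n) = f s [^]\<^bsub>add_monoid B\<^esub> n" if "s \<in> carrier A" for s and n :: nat
    using hom_nat_pow[OF hom _ A.a_group B.a_group, of s n] that by simp
  have pow_closed: "s [^]\<^bsub>add_monoid A\<^esub> n \<in> carrier A" if "s \<in> carrier A" for s and n :: nat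
    using monoid.nat_pow_closed[OF group.is_monoid[OF A.a_group], of s n] that by simp
  show "star_annihilated n A" if *: "star_annihilated n B"
    unfolding star_annihilated_def
  proof (intro ballI impI)
    fix s t r assume str: "s \<in> carrier A" "t \<in> carrier A" "r \<in> carrier A"
      and "s \<otimes>\<^bsub>A\<^esub> t = s \<oplus>\<^bsub>A\<^esub> t \<oplus>\<^bsub>A\<^esub> r"
    then have "f s \<otimes>\<^bsub>B\<^esub> f t = f s \<oplus>\<^bsub>B\<^esub> f t \<oplus>\<^bsub>B\<^esub> f r"
      by (simp flip: add mult)
    then have "f r [^]\<^bsub>add_monoid B\<^esub> n = \<zero>\<^bsub>B\<^esub>"
      using * str closed unfolding star_annihilated_def by blast
    then have "f (r [^]\<^bsub>add_monoid A\<^esub> n) = f \<zero>\<^bsub>A\<^esub>"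
      using pow[OF str(3), of n] zero by metis
    then show "r [^]\<^bsub>add_monoid A\<^esub> n = \<zero>\<^bsub>A\<^esub>"
      using eq pow_closed[OF str(3)] A.zero_closed by blast
  qed
  show "star_doubled B" if *: "star_doubled A"
    unfolding star_doubled_def im
  proof clarify
    fix s t assume st: "s \<in> carrier A" "t \<in> carrier A"
    then obtain r where r: "r \<in> carrier A" "s \<otimes>\<^bsub>A\<^esub> t = s \<oplus>\<^bsub>A\<^esub> t \<oplus>\<^bsub>A\<^esub> (r \<oplus>\<^bsub>A\<^esub> r)"
      using * unfolding star_doubled_def by blast
    then have "f s \<otimes>\<^bsub>B\<^esub> f t = f s \<oplus>\<^bsub>B\<^esub> f t \<oplus>\<^bsub>B\<^esub> (f r \<oplus>\<^bsub>B\<^esub> f r)"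
      using st by (simp flip: add mult)
    then show "\<exists>r\<in>f ` carrier A. f s \<otimes>\<^bsub>B\<^esub> f t = f s \<oplus>\<^bsub>B\<^esub> f t \<oplus>\<^bsub>B\<^esub> (r \<oplus>\<^bsub>B\<^esub> r)"
      using r by blast
  qed
  show "has_annihilating_involution B" if "has_annihilating_involution A"
  proof -
    obtain s where s: "s \<in> carrier A" "s \<oplus>\<^bsub>A\<^esub> s = \<zero>\<^bsub>A\<^esub>"
      "\<And>r. r \<in> carrier A \<Longrightarrow> s \<noteq> r \<oplus>\<^bsub>A\<^esub> r"
      "\<And>t. t \<in> carrier A \<Longrightarrow> s \<otimes>\<^bsub>A\<^esub> t = s \<oplus>\<^bsub>A\<^esub> t"
      using \<open>has_annihilating_involution A\<close> unfolding has_annihilating_involution_def by blast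
    show ?thesis
      unfolding has_annihilating_involution_def im
    proof (intro bexI conjI ballI)
      show "f s \<oplus>\<^bsub>B\<^esub> f s = \<zero>\<^bsub>B\<^esub>"
        using s by (simp flip: add zero)
      show "f s \<noteq> r \<oplus>\<^bsub>B\<^esub> r" if "r \<in> f ` carrier A" for r
        using that s by (auto simp: eq simp flip: add)
      show "f s \<otimes>\<^bsub>B\<^esub> t = f s \<oplus>\<^bsub>B\<^esub> t" if "t \<in> f ` carrier A" for t
        using that s by (auto simp flip: add mult)
    qed (use s in simp)
  qed
qed

section \<open>Values of the invariants on the family\<close>

context mmc_params
begin

text \<open>The product of \<open>(1, 0)\<close> with itself is \<open>(2^k, c)\<close>, which
  forces \<open>k' \<le> k\<close>. Conversely, the first component of every product is divisible by
  \<open>2^k'\<close>, and \<open>k' \<le> m\<close> leaves at least one factor \<open>2\<close> to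
  kill the second component.\<close>

lemma star_annihilated_iff:
  assumes k': "2 \<le> k'" "k' \<le> m"
  shows "star_annihilated (2 ^ (m + 1 - k')) A \<longleftrightarrow> k' \<le> k"
proof
  assume ann: "star_annihilated (2 ^ (m + 1 - k')) A"
  have "e 1 0 \<otimes>\<^bsub>A\<^esub> e 1 0 = e 1 0 \<oplus>\<^bsub>A\<^esub> e 1 0 \<oplus>\<^bsub>A\<^esub> e (2 ^ k) c"
    by (simp add: brace_mult mmc_brace_add circ1_def circ2_def)
  then have "e (2 ^ k) c [^]\<^bsub>add_monoid A\<^esub> (2 ^ (m + 1 - k') :: nat) = \<zero>\<^bsub>A\<^esub>"
    using ann enc_carrier unfolding star_annihilated_def by blast
  then have "e (int (2 ^ (m + 1 - k')) * 2 ^ k) (int (2 ^ (m + 1 - k')) * c) = \<zero>\<^bsub>A\<^esub>"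
    unfolding add_pow_enc .
  then have "(2 :: int) ^ (m + 1) dvd 2 ^ (m + 1 - k') * 2 ^ k"
    by (simp add: mmc_brace_zero enc_eq_iff)
  then have "m + 1 \<le> m + 1 - k' + k"
    using dvd_power_iff[of "2 :: int" "m + 1" "m + 1 - k' + k"] by (simp add: power_add)
  then show "k' \<le> k"
    using k' by simp
next
  assume le: "k' \<le> k"
  show "star_annihilated (2 ^ (m + 1 - k')) A"
    unfolding star_annihilated_def
  proof (intro ballI impI)
    fix s t r assume "s \<in> carrier A" "t \<in> carrier A" "r \<in> carrier A"
      and *: "s \<otimes>\<^bsub>A\<^esub> t = s \<oplus>\<^bsub>A\<^esub> t \<oplus>\<^bsub>A\<^esub> r"
    then obtain x y x' y' u v where str: "s = e x y" "t = e x' y'" and r: "r = e u v"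
      by (elim mmc_brace_cases)
    have "2 ^ (m + 1) dvd f x y x' y' - (x + x' + u)"
      using * by (simp add: str r brace_mult mmc_brace_add enc_eq_iff del: power_Suc)
    then have "2 ^ k' dvd f x y x' y' - (x + x' + u)"
      by (rule power_le_dvd) (use k' in simp)
    moreover have "2 ^ k' dvd f x y x' y' - x - x'"
    proof -
      have "(2 :: int) ^ k' dvd 2 ^ k" "(2 :: int) ^ k' dvd 2 ^ m"
        using le k' by (simp_all add: le_imp_power_dvd)
      \<comment> \<open>The evenness of \<open>x' * (x' - 1)\<close> upgrades the factor
        \<open>2^(m-1)\<close> to \<open>2^m\<close>, which is needed when
        \<open>k' = m\<close>.\<close>
      moreover have "f x y x' y' - x - x' = 2 ^ k * (x * x') + 2 ^ m * (d * x * y' + (1 - d) * x' * y)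
          + 2 ^ m * (c * x * n)" if n: "x' * (x' - 1) = 2 * n" for n
      proof -
        have "2 ^ (m - 1) * (x' * (x' - 1)) = 2 ^ m * n"
          unfolding n using m by (cases m) simp_all
        then have "c * x * (2 ^ (m - 1) * (x' * (x' - 1))) = 2 ^ m * (c * x * n)"
          by simp
        then show ?thesis
          unfolding circ1_def by (simp add: algebra_simps)
      qed
      moreover have "even (x' * (x' - 1))"
        by simp
      ultimately show ?thesis
        by (metis dvd_add dvd_mult2 evenE)
    qed
    ultimately have "2 ^ k' dvd (f x y x' y' - x - x') - (f x y x' y' - (x + x' + u))"
      by (rule dvd_diff[rotated])
    then have "2 ^ k' dvd u"
      by simp
    then have "2 ^ (m + 1 - k') * 2 ^ k' dvd 2 ^ (m + 1 - k') * u"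
      by (rule mult_dvd_mono[OF dvd_refl])
    then have "2 ^ (m + 1) dvd 2 ^ (m + 1 - k') * u"
      using k' by (simp flip: power_add)
    moreover have "2 dvd 2 ^ (m + 1 - k') * v"
      using k' by simp
    ultimately have "e (int (2 ^ (m + 1 - k')) * u) (int (2 ^ (m + 1 - k')) * v) = \<zero>\<^bsub>A\<^esub>"
      by (simp add: mmc_brace_zero enc_eq_iff)
    then show "r [^]\<^bsub>add_monoid A\<^esub> (2 ^ (m + 1 - k') :: nat) = \<zero>\<^bsub>A\<^esub>"
      unfolding r add_pow_enc .
  qed
qed

text \<open>The first component of a product is always even, so only the second one,
  \<open>c * x * x'\<close>, matters; \<open>(1, 0)\<close> tests it.\<close>

lemma star_doubled_iff: "star_doubled A \<longleftrightarrow> even c"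
proof
  assume "star_doubled A"
  then obtain r where "r \<in> carrier A" "e 1 0 \<otimes>\<^bsub>A\<^esub> e 1 0 = e 1 0 \<oplus>\<^bsub>A\<^esub> e 1 0 \<oplus>\<^bsub>A\<^esub> (r \<oplus>\<^bsub>A\<^esub> r)"
    using enc_carrier unfolding star_doubled_def by blast
  moreover from this obtain u v where "r = e u v"
    by (elim mmc_brace_cases)
  ultimately have "even (c - (v + v))"
    by (simp add: brace_mult mmc_brace_add enc_eq_iff circ2_def)
  then show "even c"
    by simp
next
  assume "even c"
  obtain P R where pow: "(2 :: int) ^ (m + 1) = 16 * R" "(2 :: int) ^ m = 8 * R"
      "(2 :: int) ^ (m - 1) = 4 * R" "(2 :: int) ^ k = 4 * P"
    by (rule powers)
  show "star_doubled A"
    unfolding star_doubled_def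
  proof (intro ballI)
    fix s t assume "s \<in> carrier A" "t \<in> carrier A"
    then obtain x y x' y' where str: "s = e x y" "t = e x' y'"
      by (elim mmc_brace_cases)
    define u where "u = 2 * P * x * x' + 4 * R * (d * x * y' + (1 - d) * x' * y)
      + 2 * c * R * x * x' * (x' - 1)"
    have "f x y x' y' = x + x' + (u + u)"
      unfolding circ1_def pow u_def by (simp add: algebra_simps)
    then have "s \<otimes>\<^bsub>A\<^esub> t = s \<oplus>\<^bsub>A\<^esub> t \<oplus>\<^bsub>A\<^esub> (e u 0 \<oplus>\<^bsub>A\<^esub> e u 0)"
      using \<open>even c\<close> by (simp add: str brace_mult mmc_brace_add enc_eq_iff circ2_def)
    then show "\<exists>r\<in>carrier A. s \<otimes>\<^bsub>A\<^esub> t = s \<oplus>\<^bsub>A\<^esub> t \<oplus>\<^bsub>A\<^esub> (r \<oplus>\<^bsub>A\<^esub> r)"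
      using enc_carrier by blast
  qed
qed

text \<open>An involution outside \<open>2A\<close> has the form \<open>(2^m * z, y)\<close> with
  \<open>y\<close> odd. Its product with \<open>(1, 0)\<close> has first component
  \<open>2^m * (1 - d) * y\<close> modulo \<open>2^(m+1)\<close>, which vanishes only for odd
  \<open>d\<close>; in that case \<open>(0, 1)\<close> serves as witness.\<close>

lemma has_annihilating_involution_iff: "has_annihilating_involution A \<longleftrightarrow> odd d"
proof
  obtain P R where pow: "(2 :: int) ^ (m + 1) = 16 * R" "(2 :: int) ^ m = 8 * R"
      "(2 :: int) ^ (m - 1) = 4 * R" "(2 :: int) ^ k = 4 * P"
    by (rule powers)
  have "R \<noteq> 0"
    using pow(2) by (metis mult_zero_right power_not_zero zero_neq_numeral)
  assume "has_annihilating_involution A"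
  then obtain s where s: "s \<in> carrier A" "s \<oplus>\<^bsub>A\<^esub> s = \<zero>\<^bsub>A\<^esub>"
      "\<And>r. r \<in> carrier A \<Longrightarrow> s \<noteq> r \<oplus>\<^bsub>A\<^esub> r"
      "s \<otimes>\<^bsub>A\<^esub> e 1 0 = s \<oplus>\<^bsub>A\<^esub> e 1 0"
    using enc_carrier unfolding has_annihilating_involution_def by blast
  obtain x y where xy: "s = e x y"
    using s(1) by (rule mmc_brace_cases)
  have "16 * R dvd x + x"
    using s(2) by (simp only: xy mmc_brace_add mmc_brace_zero enc_eq_iff pow diff_zero)
  then obtain z where x: "x = 8 * R * z"
    using \<open>R \<noteq> 0\<close> by (auto elim!: dvdE)
  have "odd y"
  proof
    assume "even y"
    \<comment> \<open>Here \<open>4 * R * z\<close> is half of \<open>x\<close>, so \<open>s\<close>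
      would be a double.\<close>
    then have "s = e (4 * R * z) 0 \<oplus>\<^bsub>A\<^esub> e (4 * R * z) 0"
      by (simp add: xy x mmc_brace_add enc_eq_iff)
    then show False
      using s(3) enc_carrier by blast
  qed
  have "16 * R dvd f x y 1 0 - (x + 1)"
    using s(4) unfolding xy brace_mult mmc_brace_add enc_eq_iff pow by blast
  also have "f x y 1 0 - (x + 1) = 16 * R * (2 * P * z) + 8 * R * ((1 - d) * y)"
    unfolding circ1_def pow x by (simp add: algebra_simps)
  finally have "16 * R dvd 8 * R * ((1 - d) * y)"
    by (simp add: dvd_add_right_iff)
  then have "8 * R * 2 dvd 8 * R * ((1 - d) * y)"
    by (simp add: mult.commute)
  then have "even ((1 - d) * y)"
    using \<open>R \<noteq> 0\<close> by (subst (asm) dvd_mult_cancel_left) simp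
  then show "odd d"
    using \<open>odd y\<close> by simp
next
  assume d: "odd d"
  show "has_annihilating_involution A"
    unfolding has_annihilating_involution_def
  proof (intro bexI conjI ballI)
    show "e 0 1 \<in> carrier A"
      by (rule enc_carrier)
    show "e 0 1 \<oplus>\<^bsub>A\<^esub> e 0 1 = \<zero>\<^bsub>A\<^esub>"
      by (simp add: mmc_brace_add mmc_brace_zero enc_eq_iff)
    show "e 0 1 \<noteq> r \<oplus>\<^bsub>A\<^esub> r" if "r \<in> carrier A" for r
      using that by (auto elim!: mmc_brace_cases simp: mmc_brace_add enc_eq_iff)
    show "e 0 1 \<otimes>\<^bsub>A\<^esub> t = e 0 1 \<oplus>\<^bsub>A\<^esub> t" if "t \<in> carrier A" for t
    proof -
      obtain x y where t: "t = e x y"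
        using \<open>t \<in> carrier A\<close> by (rule mmc_brace_cases)
      obtain n where "d = 2 * n + 1"
        using d by (rule oddE)
      then have "f 0 1 x y - (0 + x) = 2 ^ (m + 1) * (- n * x)"
        by (simp add: circ1_def algebra_simps)
      then show ?thesis
        unfolding t brace_mult mmc_brace_add enc_eq_iff by (simp add: circ2_def)
    qed
  qed
qed

end

section \<open>The lower bound\<close>

theorem corollary6p7:
  fixes m :: nat
  assumes "m \<ge> 3"
  shows "card (brace_iso_classes (noncyclic_mmc_braces m)) \<ge> 4 * m - 5"
proof -
  let ?S = "noncyclic_mmc_braces m"
  let ?I = "{2..m} \<times> {0, 1 :: int} \<times> {0, 1 :: int}"
  let ?F = "\<lambda>(k, c, d). mmc_brace m k c d"
  have brace: "brace A" if "A \<in> ?S" for A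
    using that by (simp add: noncyclic_mmc_braces_def modular_maximal_cyclic_brace_def)
  have S_iso: "A \<cong> modular_maximal_cyclic_group m" if "A \<in> ?S" for A
    using that by (simp add: noncyclic_mmc_braces_def modular_maximal_cyclic_brace_def)
  \<comment> \<open>One finite member of the family shows that the presented group is finite; hence
    all braces in \<open>?S\<close> have the same finite order.\<close>
  have "mmc_brace m 2 0 0 \<cong> modular_maximal_cyclic_group m"
    by (rule mmc_params.iso_mmc_group) (use assms in unfold_locales, auto)
  then have "finite (carrier (modular_maximal_cyclic_group m))"
    by (auto dest!: iso_finite simp: mmc_brace_carrier)
  then have fin: "finite (brace_iso_classes ?S)"
    using brace iso_finite[OF S_iso] iso_same_card[OF S_iso]
    by (intro finite_brace_iso_classes) blast+
  have "card ?I \<le> card (brace_iso_classes ?S)"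
  proof (rule card_le_brace_iso_classes[OF brace fin])
    show "?F ` ?I \<subseteq> ?S"
      using assms by (auto intro!: mmc_params.mmc_brace_in mmc_params.intro)
    fix p q assume pq: "p \<in> ?I" "q \<in> ?I" and iso: "brace_isomorphic (?F p) (?F q)"
    obtain k c d k' c' d' where p: "p = (k, c, d)" and q: "q = (k', c', d')"
      by (metis prod_cases3)
    interpret p: mmc_params m k c d
      using pq assms by unfold_locales (auto simp: p)
    interpret q: mmc_params m k' c' d'
      using pq assms by unfold_locales (auto simp: q)
    have 1: "brace_isomorphic p.A q.A"
      using iso by (simp add: p q)
    have 2: "brace_isomorphic q.A p.A"
      by (rule brace_isomorphic_sym[OF p.brace_mmc_brace 1])
    note inv = brace_iso_invariants[OF p.brace_mmc_brace q.brace_mmc_brace 1]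
      brace_iso_invariants[OF q.brace_mmc_brace p.brace_mmc_brace 2]
    \<comment> \<open>Each brace satisfies \<open>star_annihilated\<close> at the exponent given by
      its own parameter; transporting this to the other brace yields one inequality each.\<close>
    have "k \<le> k'" "k' \<le> k"
      using inv(1)[of "2 ^ (m + 1 - k')"] inv(4)[of "2 ^ (m + 1 - k)"]
        p.star_annihilated_iff q.star_annihilated_iff p.k q.k by auto
    moreover have "even c \<longleftrightarrow> even c'"
      using inv(2,5) p.star_doubled_iff q.star_doubled_iff by blast
    moreover have "odd d \<longleftrightarrow> odd d'"
      using inv(3,6) p.has_annihilating_involution_iff q.has_annihilating_involution_iff by blast
    ultimately show "p = q"
      using pq by (auto simp: p q)
  qed
  then show ?thesis
    \<comment> \<open>The index set has \<open>4 * (m - 1)\<close> elements.\<close>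
    using assms by (simp add: card_cartesian_product)
qed

end
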